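(* Let $a,b,c,d\in\mathbb{R}$ with $ad-bc\neq 0$, put $u=ax+by$, $v=cx+dy$, and let $M$ be the affine translation surface of Type 1 in the isotropic 3-space $\mathbb{I}^3$ given as the graph of $z(x,y)=f(u)+g(v)$ with $f,g$ smooth real functions of one variable. Suppose that $M$ is linear Weingarten in the sense that there are constants $m_0,n_0\in\mathbb{R}$ such that its relative curvature $K$ and isotropic mean curvature $H$ satisfy $$K+2m_0H=n_0.$$ Then one of the following holds: (i) $M$ is a quadric surface given by $$z(x,y)=c_1u^2+c_2v^2+c_3u+c_4v+c_5,\quad c_1,\dots,c_5\in\mathbb{R};$$ (ii) $M$ is of the form either $$z(x,y)=f(u)-\frac{m_0(a^2+b^2)}{2(ad-bc)^2}v^2+c_1v+c_2,\quad f'''\neq 0,\ c_1,c_2\in\mathbb{R},$$ or $$z(x,y)=g(v)-\frac{m_0(c^2+d^2)}{2(ad-bc)^2}u^2+c_1u+c_2,\quad g'''\neq 0,\ c_1,c_2\in\mathbb{R}.$$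
   Context: The isotropic 3-space $\mathbb{I}^3$ is the real affine 3-space with coordinates $(x,y,z)$ endowed with the degenerate metric $ds^2=dx^2+dy^2$. For a graph surface $z=z(x,y)$ of a smooth function, the relative (isotropic Gaussian) curvature is $K=\det\mathcal{H}(z)=z_{xx}z_{yy}-z_{xy}^2$ and the isotropic mean curvature is $H=\tfrac12\operatorname{trace}\mathcal{H}(z)=\tfrac12(z_{xx}+z_{yy})$, where $\mathcal{H}(z)$ is the Hessian matrix of $z$. An affine translation surface of Type 1 is the graph of $z(x,y)=f(ax+by)+g(cx+dy)$ with $ad-bc\ne0$; the pair $(u,v)=(ax+by,cx+dy)$ is called the affine parameter coordinates. Here $f$ and $g$ are smooth functions on open intervals $I$ and $J$, and the graph is taken over $\{(x,y): ax+by\in I,\ cx+dy\in J\}$. Primes denote derivatives of $f$ with respect to $u$ and of $g$ with respect to $v$. The condition $f'''\neq0$ (resp. $g'''\neq 0$) means that $f'''$ (resp. $g'''$) is not the zero function. A quadric surface in $\mathbb{I}^3$ is the set of points satisfying an equation of the second degree. *)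

theory Defs
  imports "HOL-Analysis.Analysis"
begin

text \<open>
  Smoothness of a real function on an open set. Values outside the set are irrelevant, since
  all derivatives at a point of an open set are determined by the values near that point.
\<close>

definition smooth_on :: "(real \<Rightarrow> real) \<Rightarrow> real set \<Rightarrow> bool" where
  "smooth_on f S \<longleftrightarrow> (\<forall>k. (deriv ^^ k) f differentiable_on S)"

definition partial_x :: "(real \<Rightarrow> real \<Rightarrow> real) \<Rightarrow> real \<Rightarrow> real \<Rightarrow> real" where
  "partial_x z x y = deriv (\<lambda>s. z s y) x"

definition partial_y :: "(real \<Rightarrow> real \<Rightarrow> real) \<Rightarrow> real \<Rightarrow> real \<Rightarrow> real" where
  "partial_y z x y = deriv (\<lambda>t. z x t) y"

definition hessian :: "(real \<Rightarrow> real \<Rightarrow> real) \<Rightarrow> real \<Rightarrow> real \<Rightarrow> real ^ 2 ^ 2" where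
  "hessian z x y =
     vector [vector [partial_x (partial_x z) x y, partial_y (partial_x z) x y],
             vector [partial_x (partial_y z) x y, partial_y (partial_y z) x y]]"

text \<open>
  Curvatures of the graph of \<open>z\<close> in isotropic 3-space. The degenerate metric of the ambient
  space has the Euclidean plane as its projection, so these are the determinant and half the
  trace of the Hessian in the coordinates \<open>(x, y)\<close>, with no metric correction terms.
\<close>

definition relative_curvature :: "(real \<Rightarrow> real \<Rightarrow> real) \<Rightarrow> real \<Rightarrow> real \<Rightarrow> real" where
  "relative_curvature z x y = det (hessian z x y)"

definition isotropic_mean_curvature :: "(real \<Rightarrow> real \<Rightarrow> real) \<Rightarrow> real \<Rightarrow> real \<Rightarrow> real" where
  "isotropic_mean_curvature z x y = trace (hessian z x y) / 2"

definition graph_surface ::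
    "(real \<times> real) set \<Rightarrow> (real \<Rightarrow> real \<Rightarrow> real) \<Rightarrow> (real \<times> real \<times> real) set" where
  "graph_surface D z = {(x, y, z x y) | x y. (x, y) \<in> D}"

definition affine_domain ::
    "real \<Rightarrow> real \<Rightarrow> real \<Rightarrow> real \<Rightarrow> real set \<Rightarrow> real set \<Rightarrow> (real \<times> real) set" where
  "affine_domain a b c d I J = {(x, y). a * x + b * y \<in> I \<and> c * x + d * y \<in> J}"

definition affine_translation ::
    "real \<Rightarrow> real \<Rightarrow> real \<Rightarrow> real \<Rightarrow> (real \<Rightarrow> real) \<Rightarrow> (real \<Rightarrow> real) \<Rightarrow> real \<Rightarrow> real \<Rightarrow> real" where
  "affine_translation a b c d f g x y = f (a * x + b * y) + g (c * x + d * y)"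

text \<open>
  An equation of the second degree has at least one nonzero quadratic coefficient. Degenerate
  quadrics are allowed; in particular a plane is a quadric (a double plane).
\<close>

definition quadric_surface :: "(real \<times> real \<times> real) set \<Rightarrow> bool" where
  "quadric_surface Q \<longleftrightarrow>
     (\<exists>q11 q22 q33 q12 q13 q23 l1 l2 l3 k :: real.
        (q11, q22, q33, q12, q13, q23) \<noteq> (0, 0, 0, 0, 0, 0) \<and>
        Q = {(x, y, z). q11 * x\<^sup>2 + q22 * y\<^sup>2 + q33 * z\<^sup>2 + q12 * x * y + q13 * x * z + q23 * y * z
                        + l1 * x + l2 * y + l3 * z + k = 0})"

text \<open>
  A surface lying over a planar domain \<open>D\<close> is a quadric if it consists of all points of some
  quadric whose projection lies in \<open>D\<close>; for \<open>D = UNIV\<close> this is \<open>quadric_surface\<close> itself.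
\<close>

definition quadric_surface_over ::
    "(real \<times> real) set \<Rightarrow> (real \<times> real \<times> real) set \<Rightarrow> bool" where
  "quadric_surface_over D M \<longleftrightarrow>
     (\<exists>Q. quadric_surface Q \<and> M = {(x, y, z). (x, y, z) \<in> Q \<and> (x, y) \<in> D})"

end

(*
  In the coordinates u, v the condition K + 2 m0 H = n0 reads, with D = ad - bc,
    f''(u) (D^2 g''(v) + m0 (a^2 + b^2)) = n0 - m0 (c^2 + d^2) g''(v),
  where u and v vary independently. If f'' takes two values, subtracting the two equations
  forces D^2 g'' + m0 (a^2 + b^2) = 0, so g is a quadratic polynomial; symmetrically for g''.
  Otherwise f'' and g'' are both constant and z is a quadratic polynomial in x, y.
*)
theory Submission
  imports Defs
begin

section \<open>Calculus of one variable on open intervals\<close>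

lemma smooth_on_deriv: "smooth_on f S \<Longrightarrow> smooth_on (deriv f) S"
  unfolding smooth_on_def by (metis comp_apply funpow_Suc_right)

lemma smooth_on_has_real_derivative:
  assumes "smooth_on f S" "open S" "t \<in> S"
  shows "(f has_real_derivative deriv f t) (at t)"
proof -
  have "f differentiable_on S"
    using assms(1) unfolding smooth_on_def by (metis funpow_0)
  then have "f differentiable (at t)"
    using assms(2,3) differentiable_on_eq_differentiable_at by blast
  then show ?thesis
    using DERIV_deriv_iff_real_differentiable by blast
qed

lemma constant_if_deriv_zero:
  fixes f :: "real \<Rightarrow> real"
  assumes "is_interval S" "\<And>t. t \<in> S \<Longrightarrow> (f has_real_derivative 0) (at t)"
  obtains k where "\<And>t. t \<in> S \<Longrightarrow> f t = k"
proof -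
  have "\<exists>k. \<forall>t\<in>S. f t = k"
    using assms
    by (intro has_field_derivative_zero_constant)
       (auto simp: is_interval_convex_1 intro: has_field_derivative_at_within)
  then show thesis using that by blast
qed

text \<open>Two integrations: first \<open>deriv f t - k * t\<close>, then \<open>f t\<close> minus
  the quadratic and linear terms, has zero derivative on the interval. The leading coefficient stays
  tied to \<open>k\<close>, which later yields the coefficient prescribed in case (ii).\<close>

lemma quadratic_if_second_deriv_constant:
  assumes S: "open S" "is_interval S" and f: "smooth_on f S"
    and k: "\<And>t. t \<in> S \<Longrightarrow> deriv (deriv f) t = k"
  obtains p q where "\<And>t. t \<in> S \<Longrightarrow> f t = k / 2 * t\<^sup>2 + p * t + q"
proof -
  note d1 = smooth_on_has_real_derivative[OF f S(1)]
  note d2 = smooth_on_has_real_derivative[OF smooth_on_deriv[OF f] S(1)]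
  have "((\<lambda>t. deriv f t - k * t) has_real_derivative 0) (at t)" if "t \<in> S" for t
    using d2[OF that] k[OF that] by (auto intro!: derivative_eq_intros)
  then obtain p where p: "\<And>t. t \<in> S \<Longrightarrow> deriv f t - k * t = p"
    using constant_if_deriv_zero[OF S(2)] by blast
  have "((\<lambda>t. f t - (k / 2 * t\<^sup>2 + p * t)) has_real_derivative 0) (at t)" if "t \<in> S" for t
    using d1[OF that] p[OF that] by (auto intro!: derivative_eq_intros)
  then obtain q where "\<And>t. t \<in> S \<Longrightarrow> f t - (k / 2 * t\<^sup>2 + p * t) = q"
    using constant_if_deriv_zero[OF S(2)] by blast
  then have "f t = k / 2 * t\<^sup>2 + p * t + q" if "t \<in> S" for t
    using that by force
  then show thesis using that by blast
qed

text \<open>If f''' vanished on all of \<open>S\<close>, then f'' would be constant there, because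
  \<open>S\<close> is an interval. This turns the case hypothesis that f'' takes two values into the
  condition of case (ii).\<close>

lemma ex_third_deriv_nonzero:
  assumes S: "open S" "is_interval S" and f: "smooth_on f S"
    and ne: "s \<in> S" "t \<in> S" "deriv (deriv f) s \<noteq> deriv (deriv f) t"
  shows "\<exists>u\<in>S. (deriv ^^ 3) f u \<noteq> 0"
proof (rule ccontr)
  assume "\<not> ?thesis"
  then have "deriv (deriv (deriv f)) u = 0" if "u \<in> S" for u
    using that by (auto simp: numeral_3_eq_3)
  then have "(deriv (deriv f) has_real_derivative 0) (at u)" if "u \<in> S" for u
    using smooth_on_has_real_derivative[OF smooth_on_deriv[OF smooth_on_deriv[OF f]] S(1) that]
      that by simp
  then obtain k where "\<And>u. u \<in> S \<Longrightarrow> deriv (deriv f) u = k"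
    using constant_if_deriv_zero[OF S(2)] by blast
  then show False using ne by simp
qed

section \<open>Partial derivatives and curvatures of translation surfaces\<close>

lemma open_affine_domain_sections:
  assumes "open I" "open J"
  shows "open {s. (s, y) \<in> affine_domain a b c d I J}"
    and "open {t. (x, t) \<in> affine_domain a b c d I J}"
  unfolding affine_domain_def
  by (auto intro!: open_Collect_conj open_vimage[unfolded vimage_def] continuous_intros assms)

text \<open>The weights \<open>p\<close>, \<open>q\<close> and the assumption on \<open>w\<close>
  only over the domain make the lemma applicable twice: to the surface with weights 1, and then to
  its first partials, which are combinations of f' and g' known only on the domain.\<close>

lemma partial_affine_translation:
  assumes "open I" "open J" "smooth_on f I" "smooth_on g J"
    and w: "\<And>x y. (x, y) \<in> affine_domain a b c d I J \<Longrightarrow>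
      w x y = p * f (a * x + b * y) + q * g (c * x + d * y)"
    and xy: "(x, y) \<in> affine_domain a b c d I J"
  shows "partial_x w x y
           = p * a * deriv f (a * x + b * y) + q * c * deriv g (c * x + d * y)"
    and "partial_y w x y
           = p * b * deriv f (a * x + b * y) + q * d * deriv g (c * x + d * y)"
proof -
  have "a * x + b * y \<in> I" "c * x + d * y \<in> J"
    using xy by (auto simp: affine_domain_def)
  then have df: "(f has_real_derivative deriv f (a * x + b * y)) (at (a * x + b * y))"
    and dg: "(g has_real_derivative deriv g (c * x + d * y)) (at (c * x + d * y))"
    using assms smooth_on_has_real_derivative by blast+
  have "((\<lambda>s. p * f (a * s + b * y) + q * g (c * s + d * y)) has_real_derivative
      p * a * deriv f (a * x + b * y) + q * c * deriv g (c * x + d * y)) (at x)"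
    by (auto intro!: derivative_eq_intros DERIV_chain2[where f = f and g = "\<lambda>s. a * s + b * y", OF df]
        DERIV_chain2[where f = g and g = "\<lambda>s. c * s + d * y", OF dg])
  \<comment> \<open>Nothing is known about \<open>w\<close> off the domain; the section through the
    point is open, so the derivative carries over from the explicit formula.\<close>
  then have "((\<lambda>s. w s y) has_real_derivative
      p * a * deriv f (a * x + b * y) + q * c * deriv g (c * x + d * y)) (at x)"
    by (rule has_field_derivative_transform_within_open
        [OF _ open_affine_domain_sections(1)[OF assms(1,2)]]) (use xy w in auto)
  then show "partial_x w x y
           = p * a * deriv f (a * x + b * y) + q * c * deriv g (c * x + d * y)"
    unfolding partial_x_def by (rule DERIV_imp_deriv)
  have "((\<lambda>t. p * f (a * x + b * t) + q * g (c * x + d * t)) has_real_derivative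
      p * b * deriv f (a * x + b * y) + q * d * deriv g (c * x + d * y)) (at y)"
    by (auto intro!: derivative_eq_intros DERIV_chain2[where f = f and g = "\<lambda>t. a * x + b * t", OF df]
        DERIV_chain2[where f = g and g = "\<lambda>t. c * x + d * t", OF dg])
  then have "((\<lambda>t. w x t) has_real_derivative
      p * b * deriv f (a * x + b * y) + q * d * deriv g (c * x + d * y)) (at y)"
    by (rule has_field_derivative_transform_within_open
        [OF _ open_affine_domain_sections(2)[OF assms(1,2)]]) (use xy w in auto)
  then show "partial_y w x y
           = p * b * deriv f (a * x + b * y) + q * d * deriv g (c * x + d * y)"
    unfolding partial_y_def by (rule DERIV_imp_deriv)
qed

text \<open>By the chain rule the Hessian is A^T diag(F, G) A, where A has rows (a, b) and (c, d).
  The determinant is therefore multiplicative, and the trace weights F and G by the squared lengths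
  of the rows.\<close>

lemma curvatures_affine_translation:
  fixes a b c d x y :: real and f g :: "real \<Rightarrow> real"
  defines "z \<equiv> affine_translation a b c d f g"
  assumes "open I" "open J" "smooth_on f I" "smooth_on g J"
    and xy: "(x, y) \<in> affine_domain a b c d I J"
  defines "F \<equiv> deriv (deriv f) (a * x + b * y)" and "G \<equiv> deriv (deriv g) (c * x + d * y)"
  shows "relative_curvature z x y = (a * d - b * c)\<^sup>2 * F * G"
    and "2 * isotropic_mean_curvature z x y = (a\<^sup>2 + b\<^sup>2) * F + (c\<^sup>2 + d\<^sup>2) * G"
proof -
  \<comment> \<open>\<open>partial1\<close> leaves the point free, since a second differentiation
    needs the first partials on the whole domain. In \<open>partial2\<close> the weights become (a,
    c) for \<open>partial_x z\<close> and (b, d) for \<open>partial_y z\<close>.\<close>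
  note partial1 = partial_affine_translation
    [OF assms(2-5), where p = 1 and q = 1 and w = z, simplified]
  note partial2 = partial_affine_translation
    [OF assms(2,3) smooth_on_deriv[OF assms(4)] smooth_on_deriv[OF assms(5)] _ xy]
  have z: "z x y = f (a * x + b * y) + g (c * x + d * y)" for x y
    by (simp add: z_def affine_translation_def)
  have "partial_x (partial_x z) x y = a * a * F + c * c * G"
    "partial_y (partial_x z) x y = a * b * F + c * d * G"
    "partial_x (partial_y z) x y = b * a * F + d * c * G"
    "partial_y (partial_y z) x y = b * b * F + d * d * G"
    unfolding F_def G_def by (intro partial2 partial1 z; assumption)+
  then show "relative_curvature z x y = (a * d - b * c)\<^sup>2 * F * G"
    "2 * isotropic_mean_curvature z x y = (a\<^sup>2 + b\<^sup>2) * F + (c\<^sup>2 + d\<^sup>2) * G"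
    unfolding relative_curvature_def isotropic_mean_curvature_def hessian_def
    by (simp_all add: det_2 trace_def sum_2 power2_eq_square algebra_simps)
qed

text \<open>Cramer's rule. This is what lets u and v vary independently over \<open>I\<close> and
  \<open>J\<close>.\<close>

lemma affine_domain_attains:
  fixes a b c d :: real
  assumes "a * d - b * c \<noteq> 0" "u \<in> I" "v \<in> J"
  obtains x y where "(x, y) \<in> affine_domain a b c d I J" "a * x + b * y = u" "c * x + d * y = v"
proof -
  define e where "e = a * d - b * c"
  define x where "x = (d * u - b * v) / e"
  define y where "y = (a * v - c * u) / e"
  have "e \<noteq> 0" using assms(1) by (simp add: e_def)
  then have "e * x = d * u - b * v" "e * y = a * v - c * u"
    by (simp_all add: x_def y_def)
  then have "e * (a * x + b * y) = e * u" "e * (c * x + d * y) = e * v"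
    unfolding e_def by algebra+
  with \<open>e \<noteq> 0\<close> have "a * x + b * y = u" "c * x + d * y = v" by simp_all
  then show thesis using that assms(2,3) by (auto simp: affine_domain_def)
qed

section \<open>Graphs over a domain and quadrics\<close>

lemma graph_surface_cong:
  "(\<And>x y. (x, y) \<in> D \<Longrightarrow> w x y = z x y) \<Longrightarrow> graph_surface D w = graph_surface D z"
  unfolding graph_surface_def by force

lemma quadric_surfaceI:
  assumes "(q11, q22, q33, q12, q13, q23) \<noteq> (0, 0, 0, 0, 0, 0)"
    and "\<And>x y z. (x, y, z) \<in> Q \<longleftrightarrow>
      q11 * x\<^sup>2 + q22 * y\<^sup>2 + q33 * z\<^sup>2 + q12 * x * y + q13 * x * z + q23 * y * z
      + l1 * x + l2 * y + l3 * z + k = 0"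
  shows "quadric_surface Q"
proof -
  have "Q = {(x, y, z). q11 * x\<^sup>2 + q22 * y\<^sup>2 + q33 * z\<^sup>2 + q12 * x * y + q13 * x * z + q23 * y * z
      + l1 * x + l2 * y + l3 * z + k = 0}"
    using assms(2) by auto
  with assms(1) show ?thesis unfolding quadric_surface_def by blast
qed

text \<open>The full graph of \<open>w\<close> over the plane serves as the quadric, and the surface
  is its part over \<open>D\<close>. The case split arises because a second-degree equation must
  have a nonzero quadratic coefficient, which \<open>w x y - z = 0\<close> lacks when
  \<open>w\<close> is affine.\<close>

lemma quadric_surface_graph_quadratic:
  fixes q11 q22 q12 l1 l2 k :: real
  defines "w \<equiv> \<lambda>x y. q11 * x\<^sup>2 + q22 * y\<^sup>2 + q12 * x * y + l1 * x + l2 * y + k"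
  shows "quadric_surface_over D (graph_surface D w)"
proof -
  have "quadric_surface {(x, y, z). z = w x y}"
  proof (cases "(q11, q22, q12) = (0, 0, 0)")
    case True
    \<comment> \<open>The plane \<open>z = l1 x + l2 y + k\<close> has to be written as the double plane
      \<open>(z - l1 x - l2 y - k)\<^sup>2 = 0\<close>.\<close>
    have "l1\<^sup>2 * x\<^sup>2 + l2\<^sup>2 * y\<^sup>2 + 1 * z\<^sup>2 + (2 * l1 * l2) * x * y + (- 2 * l1) * x * z
        + (- 2 * l2) * y * z + (2 * l1 * k) * x + (2 * l2 * k) * y + (- 2 * k) * z + k\<^sup>2
        = (z - w x y)\<^sup>2" for x y z
      using True by (simp add: w_def power2_eq_square algebra_simps)
    then show ?thesis
      by (intro quadric_surfaceI[of "l1\<^sup>2" "l2\<^sup>2" 1 "2 * l1 * l2" "- 2 * l1" "- 2 * l2"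
            _ "2 * l1 * k" "2 * l2 * k" "- 2 * k" "k\<^sup>2"]) (simp_all only:, simp_all)
  next
    case False
    have "q11 * x\<^sup>2 + q22 * y\<^sup>2 + 0 * z\<^sup>2 + q12 * x * y + 0 * x * z + 0 * y * z
        + l1 * x + l2 * y + (- 1) * z + k = w x y - z" for x y z
      by (simp add: w_def)
    then show ?thesis
      by (intro quadric_surfaceI[of q11 q22 0 q12 0 0 _ l1 l2 "- 1" k])
        (use False in \<open>simp_all only:, auto\<close>)
  qed
  then show ?thesis
    unfolding quadric_surface_over_def graph_surface_def
    by (intro exI[of _ "{(x, y, z). z = w x y}"]) auto
qed

theorem theorem3p2:
  fixes a b c d m0 n0 :: real
    and f g :: "real \<Rightarrow> real"
    and I J :: "real set"
    and D :: "(real \<times> real) set"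
    and z :: "real \<Rightarrow> real \<Rightarrow> real"
    and M :: "(real \<times> real \<times> real) set"
  assumes regular: "a * d - b * c \<noteq> 0"
    and I: "open I" "is_interval I" "I \<noteq> {}"
    and J: "open J" "is_interval J" "J \<noteq> {}"
    and smooth: "smooth_on f I" "smooth_on g J"
    and D: "D = affine_domain a b c d I J"
    and z: "z = affine_translation a b c d f g"
    and M: "M = graph_surface D z"
    and linear_weingarten:
      "\<forall>(x, y) \<in> D. relative_curvature z x y + 2 * m0 * isotropic_mean_curvature z x y = n0"
  shows
    "(\<exists>c1 c2 c3 c4 c5.
        quadric_surface_over D M \<and>
        M = graph_surface D (\<lambda>x y. let u = a * x + b * y; v = c * x + d * y in
              c1 * u\<^sup>2 + c2 * v\<^sup>2 + c3 * u + c4 * v + c5))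
     \<or> ((\<exists>u \<in> I. (deriv ^^ 3) f u \<noteq> 0) \<and>
        (\<exists>c1 c2.
          M = graph_surface D (\<lambda>x y. let u = a * x + b * y; v = c * x + d * y in
                f u - m0 * (a\<^sup>2 + b\<^sup>2) / (2 * (a * d - b * c)\<^sup>2) * v\<^sup>2 + c1 * v + c2)))
     \<or> ((\<exists>v \<in> J. (deriv ^^ 3) g v \<noteq> 0) \<and>
        (\<exists>c1 c2.
          M = graph_surface D (\<lambda>x y. let u = a * x + b * y; v = c * x + d * y in
                g v - m0 * (c\<^sup>2 + d\<^sup>2) / (2 * (a * d - b * c)\<^sup>2) * u\<^sup>2 + c1 * u + c2)))"
proof -
  let ?u = "\<lambda>x y. a * x + b * y" and ?v = "\<lambda>x y. c * x + d * y"
  define F where "F = deriv (deriv f)"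
  define G where "G = deriv (deriv g)"
  define e where "e = (a * d - b * c)\<^sup>2"
  define p where "p = m0 * (a\<^sup>2 + b\<^sup>2)"
  define q where "q = m0 * (c\<^sup>2 + d\<^sup>2)"
  have e: "e \<noteq> 0" using regular by (simp add: e_def)
  have eq: "e * F u * G v + p * F u + q * G v = n0" if uv: "u \<in> I" "v \<in> J" for u v
  proof -
    obtain x y where xy: "(x, y) \<in> D" "?u x y = u" "?v x y = v"
      using affine_domain_attains[OF regular uv] unfolding D by metis
    have "relative_curvature z x y + m0 * (2 * isotropic_mean_curvature z x y) = n0"
      using linear_weingarten xy(1) by (auto simp: algebra_simps)
    then show ?thesis
      using curvatures_affine_translation[OF I(1) J(1) smooth xy(1)[unfolded D]] xy(2,3)
      by (simp add: z F_def G_def e_def p_def q_def algebra_simps)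
  qed
  have on_D: "?u x y \<in> I" "?v x y \<in> J" if "(x, y) \<in> D" for x y
    using that by (auto simp: D affine_domain_def)
  have z_eq: "z x y = f (?u x y) + g (?v x y)" for x y
    by (simp add: z affine_translation_def)
  consider (f) s t where "s \<in> I" "t \<in> I" "F s \<noteq> F t"
    | (g) s t where "s \<in> J" "t \<in> J" "G s \<noteq> G t"
    | (quadric) "\<forall>s\<in>I. \<forall>t\<in>I. F s = F t" "\<forall>s\<in>J. \<forall>t\<in>J. G s = G t"
    by blast
  then show ?thesis
  proof cases
    case f
    have "G v = - p / e" if "v \<in> J" for v
    proof -
      \<comment> \<open>Subtracting the equations at \<open>s\<close> and \<open>t\<close> for the
        same \<open>v\<close> cancels both \<open>n0\<close> and \<open>q * G v\<close>.\<close>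
      have "(F s - F t) * (e * G v + p) = 0"
        using eq[OF f(1) that] eq[OF f(2) that] by (simp add: algebra_simps)
      with f(3) have "e * G v + p = 0" by simp
      with e show ?thesis by (simp add: field_simps)
    qed
    then obtain c1 c2 where g: "\<And>v. v \<in> J \<Longrightarrow> g v = - p / e / 2 * v\<^sup>2 + c1 * v + c2"
      using quadratic_if_second_deriv_constant[OF J(1,2) smooth(2)] unfolding G_def by blast
    have "M = graph_surface D (\<lambda>x y. let u = ?u x y; v = ?v x y in
        f u - m0 * (a\<^sup>2 + b\<^sup>2) / (2 * (a * d - b * c)\<^sup>2) * v\<^sup>2 + c1 * v + c2)"
      unfolding M using on_D g
      by (intro graph_surface_cong) (simp add: z_eq Let_def p_def e_def mult.commute)
    moreover have "\<exists>u\<in>I. (deriv ^^ 3) f u \<noteq> 0"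
      using ex_third_deriv_nonzero[OF I(1,2) smooth(1)] f unfolding F_def by blast
    ultimately show ?thesis by blast
  next
    case g
    have "F u = - q / e" if "u \<in> I" for u
    proof -
      have "(G s - G t) * (e * F u + q) = 0"
        using eq[OF that g(1)] eq[OF that g(2)] by (simp add: algebra_simps)
      with g(3) have "e * F u + q = 0" by simp
      with e show ?thesis by (simp add: field_simps)
    qed
    then obtain c1 c2 where f: "\<And>u. u \<in> I \<Longrightarrow> f u = - q / e / 2 * u\<^sup>2 + c1 * u + c2"
      using quadratic_if_second_deriv_constant[OF I(1,2) smooth(1)] unfolding F_def by blast
    have "M = graph_surface D (\<lambda>x y. let u = ?u x y; v = ?v x y in
        g v - m0 * (c\<^sup>2 + d\<^sup>2) / (2 * (a * d - b * c)\<^sup>2) * u\<^sup>2 + c1 * u + c2)"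
      unfolding M using on_D f
      by (intro graph_surface_cong) (simp add: z_eq Let_def q_def e_def mult.commute)
    moreover have "\<exists>v\<in>J. (deriv ^^ 3) g v \<noteq> 0"
      using ex_third_deriv_nonzero[OF J(1,2) smooth(2)] g unfolding G_def by blast
    ultimately show ?thesis by blast
  next
    case quadric
    \<comment> \<open>Sample points that name the constant values of F and G; they exist since
      \<open>I\<close> and \<open>J\<close> are nonempty.\<close>
    obtain u0 v0 where "u0 \<in> I" "v0 \<in> J" using I(3) J(3) by blast
    with quadric have F: "\<And>u. u \<in> I \<Longrightarrow> F u = F u0" and G: "\<And>v. v \<in> J \<Longrightarrow> G v = G v0"
      by blast+
    obtain c3 k1 where f: "\<And>u. u \<in> I \<Longrightarrow> f u = F u0 / 2 * u\<^sup>2 + c3 * u + k1"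
      using quadratic_if_second_deriv_constant[OF I(1,2) smooth(1)] F unfolding F_def by blast
    obtain c4 k2 where g: "\<And>v. v \<in> J \<Longrightarrow> g v = G v0 / 2 * v\<^sup>2 + c4 * v + k2"
      using quadratic_if_second_deriv_constant[OF J(1,2) smooth(2)] G unfolding G_def by blast
    define c1 where "c1 = F u0 / 2"
    define c2 where "c2 = G v0 / 2"
    let ?w = "\<lambda>x y. let u = ?u x y; v = ?v x y in
        c1 * u\<^sup>2 + c2 * v\<^sup>2 + c3 * u + c4 * v + (k1 + k2)"
    have M_eq: "M = graph_surface D ?w"
      unfolding M using on_D f g
      by (intro graph_surface_cong) (simp add: z_eq Let_def c1_def c2_def)
    \<comment> \<open>Quadrics are defined by equations in x, y, z, so the polynomial in u and v is
      expanded in x and y.\<close>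
    have "?w = (\<lambda>x y. (c1 * a\<^sup>2 + c2 * c\<^sup>2) * x\<^sup>2 + (c1 * b\<^sup>2 + c2 * d\<^sup>2) * y\<^sup>2
        + (2 * c1 * a * b + 2 * c2 * c * d) * x * y
        + (c3 * a + c4 * c) * x + (c3 * b + c4 * d) * y + (k1 + k2))"
      by (simp add: Let_def fun_eq_iff power2_eq_square algebra_simps)
    then have "quadric_surface_over D M"
      unfolding M_eq by (simp only: quadric_surface_graph_quadratic)
    with M_eq show ?thesis by blast
  qed
qed

end
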